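(* Let $b,c,\rho\in\mathbb{C}$ with $\operatorname{Re}(\rho)>0$. For every $t\in\mathbb{C}\setminus\{0\}$ and every $z\in\mathbb{C}$, $${}_1F_1\Big((c;\rho),1;\big(t-\tfrac{b}{t}\big)\tfrac{z}{2}\Big)=\sum_{n=-\infty}^{\infty}G_n^{(b,c)}(z;\rho)\,t^n .$$
   Context: For $\rho\in\mathbb{C}$ with $\operatorname{Re}(\rho)>0$ and $x\in\mathbb{C}$ put $\Gamma_\rho(x)=\int_0^\infty t^{x-1}e^{-t-\rho/t}\,dt$. The generalized Pochhammer symbol is $(\lambda;\rho)_\nu:=\Gamma_\rho(\lambda+\nu)/\Gamma(\lambda)$ for $\lambda,\nu\in\mathbb{C}$, where $1/\Gamma$ is read as an entire function (zero at $0,-1,-2,\dots$). The unified four parameter Bessel function is $$G_\nu^{(b,c)}(z;\rho):=\sum_{k=0}^\infty \frac{(-b)^k (c;\rho)_{2k+\nu}}{\Gamma(\nu+k+1)\,\Gamma(\nu+2k+1)}\,\frac{(z/2)^{2k+\nu}}{k!},$$ used here for all integer orders $\nu=n$ (terms whose coefficient vanishes because $1/\Gamma=0$ are omitted). The extended confluent hypergeometric function is ${}_1F_1((c;\rho),d;x):=\sum_{n=0}^\infty \frac{(c;\rho)_n}{(d)_n}\frac{x^n}{n!}$, where $(d)_n=\Gamma(d+n)/\Gamma(d)$ is the usual Pochhammer symbol. *)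

theory Defs
  imports "HOL-Analysis.Analysis"
begin

definition Gamma_ext :: "complex \<Rightarrow> complex \<Rightarrow> complex" where
  "Gamma_ext \<rho> x =
     (LBINT t:{0<..}. complex_of_real t powr (x - 1) * exp (- complex_of_real t - \<rho> / complex_of_real t))"

text \<open>The library function \<^const>\<open>rGamma\<close> is the entire function \<open>1/\<Gamma>\<close>, with value \<open>0\<close> at the
  poles of \<open>\<Gamma>\<close>.\<close>

definition pochhammer_ext :: "complex \<Rightarrow> complex \<Rightarrow> complex \<Rightarrow> complex" where
  "pochhammer_ext l \<rho> \<nu> = Gamma_ext \<rho> (l + \<nu>) * rGamma l"

text \<open>The order \<open>n\<close> is an integer, so the power of \<open>z/2\<close> is an integer power and \<open>0\<close> to the power
  \<open>0\<close> is \<open>1\<close> (complex \<open>powr\<close> would give \<open>0\<close> there). Whenever the exponent \<open>2k + n\<close> is negative,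
  the factor \<^term>\<open>rGamma (of_int n + 2 * of_nat k + 1)\<close> is \<open>0\<close>, so the term vanishes.\<close>

definition unified_Bessel :: "complex \<Rightarrow> complex \<Rightarrow> int \<Rightarrow> complex \<Rightarrow> complex \<Rightarrow> complex" where
  "unified_Bessel b c n z \<rho> =
     (\<Sum>k. (- b) ^ k * pochhammer_ext c \<rho> (2 * of_nat k + of_int n)
            * rGamma (of_int n + of_nat k + 1) * rGamma (of_int n + 2 * of_nat k + 1)
            * ((z / 2) powi (2 * int k + n) / fact k))"

definition hyp_1F1_ext :: "complex \<Rightarrow> complex \<Rightarrow> complex \<Rightarrow> complex \<Rightarrow> complex" where
  "hyp_1F1_ext c \<rho> d x =
     (\<Sum>n. pochhammer_ext c \<rho> (of_nat n) / pochhammer d n * (x ^ n / fact n))"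

end

theory Submission
  imports Defs
begin

text \<open>
  Both sides are the same absolutely convergent double series, summed in two different orders.
  With \<open>A N = (c;\<rho>)\<^sub>N / (N!)\<^sup>2\<close>, \<open>u = t z / 2\<close> and \<open>v = - (b / t) (z / 2)\<close>, the value of \<open>\<^sub>1F\<^sub>1\<close> is
  \<open>\<Sum>N. A N * (u + v) ^ N\<close>, and the binomial theorem turns it into the double series
  \<open>\<Sum>N. \<Sum>k\<le>N. A N * (N choose k) * u ^ (N - k) * v ^ k\<close>. The power of \<open>t\<close> in the term \<open>(N, k)\<close> is
  \<open>n = N - 2 k\<close>, and that term is exactly \<open>t\<close> to the power \<open>n\<close> times the \<open>k\<close>-th term of
  the Bessel series of order \<open>n\<close> (\<open>Bessel_term_diagonal\<close>). The pairs \<open>(n, k)\<close> that arise this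
  way are those with \<open>n + k \<ge> 0\<close>; for all the others the factor \<open>1/\<Gamma>(n + k + 1)\<close> vanishes
  (\<open>Bessel_term_eq_0\<close>). Summing over \<open>k\<close> first, for fixed \<open>n\<close>, gives the right-hand side.

  The exchange needs \<open>\<Sum>N. \<bar>A N\<bar> (\<bar>u\<bar> + \<bar>v\<bar>) ^ N\<close> to converge, hence a bound on the growth of
  \<open>\<Gamma>\<^sub>\<rho>(c + N)\<close>. In the integral, \<open>t ^ N \<le> 2 ^ N N! exp (t / 2)\<close> costs only half of the decay of
  \<open>exp (- t)\<close>, and what remains is integrable because \<open>exp (- \<rho> / t)\<close> tames every singularity at
  \<open>0\<close>. So \<open>\<Gamma>\<^sub>\<rho>(c + N) = O(2 ^ N N!)\<close> (\<open>norm_Gamma_ext_add_nat_le\<close>), and the two factors \<open>N!\<close> in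
  the denominator of \<open>A N\<close> outweigh it, leaving an exponential series as a majorant.
\<close>

section \<open>Growth of the extended Gamma function\<close>

text \<open>The left-hand side divided by \<open>n!\<close> is a single term of the exponential series.\<close>

lemma power_le_fact_mult_exp:
  fixes x :: real
  assumes "x \<ge> 0"
  shows "x ^ n \<le> fact n * exp x"
proof -
  have s: "(\<lambda>k. x ^ k /\<^sub>R fact k) sums exp x"
    by (rule exp_converges)
  have "(\<Sum>k\<in>{n}. x ^ k /\<^sub>R fact k) \<le> exp x"
    unfolding sums_unique[OF s]
    by (rule sum_le_suminf) (use assms s in \<open>auto simp: sums_iff\<close>)
  then show ?thesis
    by (simp add: field_simps)
qed

lemma set_integrable_Gamma_kernel:
  fixes a s :: real
  assumes "a > 0" "s > 0"
  shows "set_integrable lborel {0<..} (\<lambda>t. t powr (a - 1) * exp (- (s * t)))"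
proof -
  have "(\<lambda>t. complex_of_real t powr (complex_of_real a - 1) / of_real (exp (s * t)))
          absolutely_integrable_on {0<..}"
    by (rule absolutely_integrable_Gamma_integral) (use assms in auto)
  then have "integrable lebesgue (\<lambda>t. norm (indicator {0<..} t *\<^sub>R
      (complex_of_real t powr (complex_of_real a - 1) / of_real (exp (s * t)))))"
    unfolding set_integrable_def by (rule integrable_norm)
  also have "(\<lambda>t. norm (indicator {0<..} t *\<^sub>R
      (complex_of_real t powr (complex_of_real a - 1) / of_real (exp (s * t)))))
     = (\<lambda>t. indicator {0<..} t *\<^sub>R (t powr (a - 1) * exp (- (s * t))))"
    by (auto simp: fun_eq_iff indicator_def norm_divide norm_powr_real_powr exp_minus field_simps)
  finally show ?thesis
    unfolding set_integrable_def by (subst (asm) integrable_completion) auto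
qed

text \<open>Two uses of \<open>y ^ n \<le> n! exp y\<close>: with \<open>y = t / 2\<close> it bounds \<open>t ^ N\<close> at the price of half of the
  exponential decay, and with \<open>y = Re \<rho> / t\<close> it trades \<open>exp (- Re \<rho> / t)\<close> for a factor \<open>t ^ M\<close>.
  Taking \<open>M > - Re x\<close> makes the right-hand side an integrable Gamma kernel; its dependence on \<open>N\<close>
  is confined to the constant in front.\<close>

lemma norm_Gamma_ext_kernel_le:
  fixes x \<rho> :: complex and t :: real
  assumes "Re \<rho> > 0" "t > 0"
  shows "norm (complex_of_real t powr (x + of_nat N - 1) * exp (- complex_of_real t - \<rho> / complex_of_real t))
           \<le> (fact M / Re \<rho> ^ M) * (2 ^ N * fact N) * (t powr (Re x + real M - 1) * exp (- (1/2 * t)))"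
proof -
  have tN: "t ^ N \<le> 2 ^ N * fact N * exp (t / 2)"
    using mult_left_mono[OF power_le_fact_mult_exp[of "t / 2" N], of "2 ^ N"] assms
    by (simp add: power_divide mult_ac)
  have "(Re \<rho> / t) ^ M \<le> fact M * exp (Re \<rho> / t)"
    using assms by (intro power_le_fact_mult_exp) auto
  then have tM: "exp (- (Re \<rho> / t)) \<le> fact M / Re \<rho> ^ M * t ^ M"
    using assms by (simp add: power_divide exp_minus field_simps)
  have "norm (complex_of_real t powr (x + of_nat N - 1) * exp (- complex_of_real t - \<rho> / complex_of_real t))
      = t powr (Re x + real N - 1) * exp (- t - Re \<rho> / t)"
    using assms by (simp add: norm_mult norm_powr_real_powr)
  also have "\<dots> = t powr (Re x - 1) * exp (- t) * (t ^ N * exp (- (Re \<rho> / t)))"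
  proof -
    have "Re x + real N - 1 = (Re x - 1) + real N" by simp
    then have "t powr (Re x + real N - 1) = t powr (Re x - 1) * t ^ N"
      using assms by (simp only: powr_add powr_realpow)
    then show ?thesis by (simp add: exp_diff exp_minus field_simps)
  qed
  also have "\<dots> \<le> t powr (Re x - 1) * exp (- t) *
      ((2 ^ N * fact N * exp (t / 2)) * (fact M / Re \<rho> ^ M * t ^ M))"
    using tN tM assms by (intro mult_left_mono mult_mono) auto
  also have "\<dots> = (fact M / Re \<rho> ^ M) * (2 ^ N * fact N) *
      ((t powr (Re x - 1) * t ^ M) * (exp (- t) * exp (t / 2)))"
    by (simp only: mult_ac)
  also have "exp (- t) * exp (t / 2) = exp (- (1/2 * t))"
    by (simp flip: exp_add)
  also have "t powr (Re x - 1) * t ^ M = t powr (Re x + real M - 1)"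
  proof -
    have "Re x + real M - 1 = (Re x - 1) + real M" by simp
    then show ?thesis using assms by (simp only: powr_add powr_realpow)
  qed
  finally show ?thesis .
qed

lemma norm_Gamma_ext_add_nat_le:
  fixes x \<rho> :: complex
  assumes "Re \<rho> > 0"
  obtains C where "\<And>N. norm (Gamma_ext \<rho> (x + of_nat N)) \<le> C * (2 ^ N * fact N)"
proof -
  obtain M :: nat where M: "real M > - Re x"
    using reals_Archimedean2 by blast
  define g where "g t = t powr (Re x + real M - 1) * exp (- (1/2 * t))" for t :: real
  define I where "I = (LBINT t:{0<..}. g t)"
  have g: "set_integrable lborel {0<..} g"
    unfolding g_def by (rule set_integrable_Gamma_kernel) (use M in auto)
  have "norm (Gamma_ext \<rho> (x + of_nat N)) \<le> (fact M / Re \<rho> ^ M * I) * (2 ^ N * fact N)" for N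
  proof -
    define f where "f t = complex_of_real t powr (x + of_nat N - 1)
      * exp (- complex_of_real t - \<rho> / complex_of_real t)" for t :: real
    define K where "K = (fact M / Re \<rho> ^ M) * (2 ^ N * fact N)"
    have le: "norm (indicator {0<..} t *\<^sub>R f t) \<le> indicator {0<..} t *\<^sub>R (K * g t)" for t
      using norm_Gamma_ext_kernel_le[OF assms, of t x N M]
      by (auto simp: indicator_def f_def g_def K_def)
    have Kg: "set_integrable lborel {0<..} (\<lambda>t. K * g t)"
      using g by (rule set_integrable_mult_right)
    have "integrable lborel (\<lambda>t. indicator {0<..} t *\<^sub>R f t)"
    proof (rule Bochner_Integration.integrable_bound)
      show "integrable lborel (\<lambda>t. indicator {0<..} t *\<^sub>R (K * g t))"
        using Kg by (simp add: set_integrable_def)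
      show "(\<lambda>t. indicator {0<..} t *\<^sub>R f t) \<in> borel_measurable lborel"
        unfolding f_def measurable_lborel2
        by (intro borel_measurable_continuous_on_indicator continuous_intros)
           (auto simp: complex_nonpos_Reals_iff)
      show "AE t in lborel. norm (indicator {0<..} t *\<^sub>R f t) \<le> norm (indicator {0<..} t *\<^sub>R (K * g t))"
        unfolding real_norm_def by (intro AE_I2 order_trans[OF le abs_ge_self])
    qed
    then have "norm (LBINT t:{0<..}. f t) \<le> (LBINT t:{0<..}. K * g t)"
      unfolding set_lebesgue_integral_def
      by (rule Bochner_Integration.integral_norm_bound_integral) (use Kg le in \<open>auto simp: set_integrable_def\<close>)
    also have "\<dots> = K * I"
      by (simp add: I_def)
    finally show ?thesis
      by (simp add: Gamma_ext_def f_def K_def mult_ac)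
  qed
  then show thesis by (rule that)
qed

section \<open>The double series and its two orders of summation\<close>

text \<open>One \<open>N!\<close> is spent on the growth of \<open>\<Gamma>\<^sub>\<rho>(c + N)\<close>; the other one leaves the exponential series
  of \<open>2 R\<close>.\<close>

lemma summable_hyp_1F1_ext_majorant:
  fixes c \<rho> :: complex and R :: real
  assumes "Re \<rho> > 0" "R \<ge> 0"
  shows "summable (\<lambda>N. norm (pochhammer_ext c \<rho> (of_nat N) / (fact N)\<^sup>2) * R ^ N)"
proof -
  obtain C where C: "\<And>N. norm (Gamma_ext \<rho> (c + of_nat N)) \<le> C * (2 ^ N * fact N)"
    using norm_Gamma_ext_add_nat_le[OF assms(1)] by blast
  show ?thesis
  proof (rule summable_comparison_test'[where N = 0])
    show "summable (\<lambda>N. (C * norm (rGamma c)) * (inverse (fact N) * (2 * R) ^ N))"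
      by (intro summable_mult summable_exp)
    show "norm (norm (pochhammer_ext c \<rho> (of_nat N) / (fact N)\<^sup>2) * R ^ N)
        \<le> (C * norm (rGamma c)) * (inverse (fact N) * (2 * R) ^ N)" for N
    proof -
      have "norm (pochhammer_ext c \<rho> (of_nat N) / (fact N)\<^sup>2) * R ^ N
          = norm (Gamma_ext \<rho> (c + of_nat N)) * (norm (rGamma c) * R ^ N / (fact N)\<^sup>2)"
        by (simp add: pochhammer_ext_def norm_mult norm_divide norm_power)
      also have "\<dots> \<le> C * (2 ^ N * fact N) * (norm (rGamma c) * R ^ N / (fact N)\<^sup>2)"
        by (intro mult_right_mono C) (use assms in auto)
      also have "\<dots> = (C * norm (rGamma c)) * (inverse (fact N) * (2 * R) ^ N)"
        by (simp add: power2_eq_square power_mult_distrib field_simps)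
      finally show ?thesis
        using assms by simp
    qed
  qed
qed

text \<open>Row \<open>N\<close> sums to \<open>A N * (u + v) ^ N\<close> by the binomial theorem. The same theorem applied to the
  norms shows that the norms in row \<open>N\<close> add up to \<open>\<bar>A N\<bar> (\<bar>u\<bar> + \<bar>v\<bar>) ^ N\<close>, which is why the
  hypothesis is exactly absolute summability of the whole triangle.\<close>

lemma has_sum_binomial_expansion:
  fixes A :: "nat \<Rightarrow> complex" and u v :: complex
  assumes "summable (\<lambda>N. norm (A N) * (norm u + norm v) ^ N)"
  shows "((\<lambda>(N, k). A N * (of_nat (N choose k) * u ^ (N - k) * v ^ k))
           has_sum (\<Sum>N. A N * (u + v) ^ N)) (SIGMA N:UNIV. {..N})"
proof (rule has_sum_SigmaI)
  have row: "(\<Sum>k\<le>N. of_nat (N choose k) * x ^ (N - k) * y ^ k) = (x + y) ^ N"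
    for x y :: "'a :: comm_semiring_1" and N
    unfolding add.commute[of x y] binomial_ring by (rule sum.cong) (simp_all add: mult_ac)
  show "((\<lambda>k. case (N, k) of (N, k) \<Rightarrow> A N * (of_nat (N choose k) * u ^ (N - k) * v ^ k))
           has_sum A N * (u + v) ^ N) {..N}" for N
    using has_sum_finite[of "{..N}" "\<lambda>k. A N * (of_nat (N choose k) * u ^ (N - k) * v ^ k)"]
    unfolding sum_distrib_left[symmetric] row by simp
  show "((\<lambda>N. A N * (u + v) ^ N) has_sum (\<Sum>N. A N * (u + v) ^ N)) UNIV"
  proof (rule norm_summable_imp_has_sum)
    show S: "summable (\<lambda>N. norm (A N * (u + v) ^ N))"
    proof (rule summable_comparison_test'[OF assms])
      show "norm (norm (A N * (u + v) ^ N)) \<le> norm (A N) * (norm u + norm v) ^ N" for N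
        by (simp add: norm_mult norm_power mult_left_mono power_mono norm_triangle_ineq)
    qed
    show "(\<lambda>N. A N * (u + v) ^ N) sums (\<Sum>N. A N * (u + v) ^ N)"
      by (rule summable_sums[OF summable_norm_cancel[OF S]])
  qed
  show "(\<lambda>(N, k). A N * (of_nat (N choose k) * u ^ (N - k) * v ^ k))
          summable_on (SIGMA N:UNIV. {..N})"
  proof (rule Infinite_Sum.abs_summable_summable, rule summable_on_SigmaI)
    show "((\<lambda>k. norm (case (N, k) of (N, k) \<Rightarrow> A N * (of_nat (N choose k) * u ^ (N - k) * v ^ k)))
             has_sum norm (A N) * (norm u + norm v) ^ N) {..N}" for N
      using has_sum_finite[of "{..N}"
          "\<lambda>k. norm (A N) * (of_nat (N choose k) * norm u ^ (N - k) * norm v ^ k)"]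
      unfolding sum_distrib_left[symmetric] row by (simp add: norm_mult norm_power)
    show "(\<lambda>N. norm (A N) * (norm u + norm v) ^ N) summable_on UNIV"
      using assms by (rule summable_nonneg_imp_summable_on) auto
  qed auto
qed

definition Bessel_term :: "complex \<Rightarrow> complex \<Rightarrow> complex \<Rightarrow> complex \<Rightarrow> int \<Rightarrow> nat \<Rightarrow> complex" where
  "Bessel_term b c \<rho> z n k =
     (- b) ^ k * pochhammer_ext c \<rho> (2 * of_nat k + of_int n)
       * rGamma (of_int n + of_nat k + 1) * rGamma (of_int n + 2 * of_nat k + 1)
       * ((z / 2) powi (2 * int k + n) / fact k)"

lemma Bessel_term_eq_0:
  assumes "n + int k < 0"
  shows "Bessel_term b c \<rho> z n k = 0"
proof -
  have "rGamma (of_int n + of_nat k + 1 :: complex) = rGamma (of_int (n + int k + 1))"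
    by simp
  also have "\<dots> = 0"
    using assms by (subst rGamma_of_int) auto
  finally show ?thesis
    by (simp add: Bessel_term_def)
qed

text \<open>With \<open>n = N - 2 k\<close> and \<open>m = N - k\<close>, the two reciprocal Gamma factors are \<open>1/m!\<close> and \<open>1/N!\<close>, so
  together with \<open>1/k!\<close> they form \<open>(N choose k) / (N!)\<^sup>2\<close>; the powers combine because \<open>n = m - k\<close>
  and \<open>N = m + k\<close>.\<close>

lemma Bessel_term_diagonal:
  assumes "t \<noteq> 0" "k \<le> N"
  shows "Bessel_term b c \<rho> z (int N - 2 * int k) k * t powi (int N - 2 * int k)
       = pochhammer_ext c \<rho> (of_nat N) / (fact N)\<^sup>2 *
           (of_nat (N choose k) * (t * (z / 2)) ^ (N - k) * (- (b / t) * (z / 2)) ^ k)"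
proof -
  define m where "m = N - k"
  have N: "N = m + k" using assms by (simp add: m_def)
  have G1: "rGamma (of_int (int N - 2 * int k) + of_nat k + 1 :: complex) = inverse (fact m)"
    using rGamma_of_int[of "int m + 1", where ?'a = complex] by (simp add: N algebra_simps)
  have G2: "rGamma (of_int (int N - 2 * int k) + 2 * of_nat k + 1 :: complex) = inverse (fact N)"
    using rGamma_of_int[of "int N + 1", where ?'a = complex] by (simp add: algebra_simps)
  have tp: "t powi (int N - 2 * int k) = t ^ m / t ^ k"
  proof -
    have "int N - 2 * int k = int m - int k" by (simp add: N)
    then show ?thesis using assms by (simp add: power_int_diff)
  qed
  have zp: "(z / 2) powi (2 * int k + (int N - 2 * int k)) = (z / 2) ^ m * (z / 2) ^ k"
  proof -
    have "2 * int k + (int N - 2 * int k) = int (m + k)" by (simp add: N)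
    then show ?thesis by (simp only: power_int_of_nat power_add)
  qed
  have ch: "of_nat (N choose k) = (fact N / (fact k * fact m) :: complex)"
    using assms by (simp add: binomial_fact m_def)
  have P: "pochhammer_ext c \<rho> (2 * of_nat k + of_int (int N - 2 * int k)) = pochhammer_ext c \<rho> (of_nat N)"
    by simp
  have "(- (b / t) * (z / 2)) ^ k = (- b) ^ k / t ^ k * (z / 2) ^ k"
    by (metis minus_divide_left power_divide power_mult_distrib)
  then show ?thesis
    unfolding Bessel_term_def G1 G2 tp zp ch P m_def[symmetric] power_mult_distrib[of t]
    by (simp add: power2_eq_square field_simps)
qed

lemma has_sum_Bessel_double_series:
  assumes \<rho>: "Re \<rho> > 0" and t: "t \<noteq> 0"
  shows "((\<lambda>(n, k). Bessel_term b c \<rho> z n k * t powi n)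
           has_sum hyp_1F1_ext c \<rho> 1 ((t - b / t) * (z / 2))) (UNIV \<times> UNIV)"
proof -
  define A where "A N = pochhammer_ext c \<rho> (of_nat N) / (fact N)\<^sup>2" for N
  define u where "u = t * (z / 2)"
  define v where "v = - (b / t) * (z / 2)"
  define F where "F = (\<lambda>(n, k). Bessel_term b c \<rho> z n k * t powi n)"
  have uv: "u + v = (t - b / t) * (z / 2)"
    by (simp add: u_def v_def algebra_simps)
  have S: "(\<Sum>N. A N * (u + v) ^ N) = hyp_1F1_ext c \<rho> 1 ((t - b / t) * (z / 2))"
    unfolding hyp_1F1_ext_def A_def uv
    by (simp add: power2_eq_square pochhammer_fact[symmetric])
  have "((\<lambda>(N, k). A N * (of_nat (N choose k) * u ^ (N - k) * v ^ k))
           has_sum (\<Sum>N. A N * (u + v) ^ N)) (SIGMA N:UNIV. {..N})"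
    by (rule has_sum_binomial_expansion)
       (unfold A_def, rule summable_hyp_1F1_ext_majorant[OF \<rho>], simp)
  \<comment> \<open>\<open>(N, k) \<mapsto> (N - 2 k, k)\<close> maps the triangle \<open>k \<le> N\<close> onto the pairs with \<open>n + k \<ge> 0\<close>, on which
    \<open>n + 2 k\<close> is nonnegative, so that \<open>nat\<close> inverts it.\<close>
  also have "?this \<longleftrightarrow> (F has_sum (\<Sum>N. A N * (u + v) ^ N)) {(n, k). n + int k \<ge> 0}"
  proof (rule has_sum_reindex_bij_witness[where
        i = "\<lambda>(n, k). (nat (n + 2 * int k), k)" and j = "\<lambda>(N, k). (int N - 2 * int k, k)"])
    show "F (case p of (N, k) \<Rightarrow> (int N - 2 * int k, k)) =
       (case p of (N, k) \<Rightarrow> A N * (of_nat (N choose k) * u ^ (N - k) * v ^ k))"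
      if "p \<in> (SIGMA N:UNIV. {..N})" for p
      using that by (auto simp: F_def A_def u_def v_def Bessel_term_diagonal[OF t])
  qed auto
  also have "\<dots> \<longleftrightarrow> (F has_sum (\<Sum>N. A N * (u + v) ^ N)) (UNIV \<times> UNIV)"
    by (rule has_sum_cong_neutral) (auto simp: F_def Bessel_term_eq_0)
  finally show ?thesis
    by (simp only: S F_def)
qed

theorem theorem2p2:
  fixes b c \<rho> t z :: complex
  assumes "Re \<rho> > 0" and "t \<noteq> 0"
  shows "((\<lambda>n::int. unified_Bessel b c n z \<rho> * t powi n)
           has_sum hyp_1F1_ext c \<rho> 1 ((t - b / t) * (z / 2))) UNIV"
proof (rule has_sum_SigmaD)
  show total: "((\<lambda>(n, k). Bessel_term b c \<rho> z n k * t powi n)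
           has_sum hyp_1F1_ext c \<rho> 1 ((t - b / t) * (z / 2))) (UNIV \<times> UNIV)"
    using assms by (rule has_sum_Bessel_double_series)
  show "((\<lambda>k. case (n, k) of (n, k) \<Rightarrow> Bessel_term b c \<rho> z n k * t powi n)
          has_sum unified_Bessel b c n z \<rho> * t powi n) UNIV" for n
  proof -
    \<comment> \<open>The Bessel series is defined by \<open>suminf\<close>; its convergence is inherited from the double series,
      after division by the nonzero power of \<open>t\<close>.\<close>
    have "(\<lambda>(n, k). Bessel_term b c \<rho> z n k * t powi n) summable_on (UNIV \<times> UNIV)"
      using total by (auto simp: summable_on_def)
    then have "(\<lambda>k. Bessel_term b c \<rho> z n k * t powi n) summable_on UNIV"
      by (rule summable_on_SigmaD1) auto
    then have "(\<lambda>k. Bessel_term b c \<rho> z n k * t powi n * inverse (t powi n)) summable_on UNIV"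
      by (rule summable_on_cmult_left)
    then have "Bessel_term b c \<rho> z n summable_on UNIV"
      using assms by (simp add: mult.assoc)
    then obtain s where s: "(Bessel_term b c \<rho> z n has_sum s) UNIV"
      by (auto simp: summable_on_def)
    moreover have "s = unified_Bessel b c n z \<rho>"
      using sums_unique[OF has_sum_imp_sums[OF s]]
      by (simp add: unified_Bessel_def Bessel_term_def[abs_def])
    ultimately show ?thesis
      using has_sum_cmult_left by auto
  qed
qed

end
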